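(* Let $G$ be a locally compact group, and $X\subset G$ a subset. Then $(G,X)$ has relative Property (T) if and only if there exists an open, compactly generated subgroup $H$ of $G$, containing $X$, such that $(H,X)$ has relative Property (T).
   Context: For a locally compact group $G$ and a subset $X\subset G$, the pair $(G,X)$ has relative Property (T) if for every net $(\varphi_i)$ of continuous normalized (i.e. $\varphi_i(1)=1$) positive definite functions on $G$ that converges to $1$ uniformly on compact subsets of $G$, the convergence is uniform on $X$. *)

theory Defs
  imports "HOL-Analysis.Analysis" "HOL-Algebra.Generated_Groups" "HOL-Library.Nonpos_Ints"
begin

text \<open>Locally compact groups are Hausdorff, as is customary.\<close>

locale locally_compact_group = group G for G (structure) and T :: "'a topology" +
  assumes topspace_eq_carrier: "topspace T = carrier G"
    and continuous_mult: "continuous_map (prod_topology T T) T (\<lambda>(x, y). x \<otimes> y)"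
    and continuous_inv: "continuous_map T T (\<lambda>x. inv x)"
    and Hausdorff: "Hausdorff_space T"
    and locally_compact: "locally_compact_space T"

definition compactly_generated :: "('a, 'b) monoid_scheme \<Rightarrow> 'a topology \<Rightarrow> bool" where
  "compactly_generated G T \<longleftrightarrow> (\<exists>K. compactin T K \<and> generate G K = carrier G)"

definition positive_definite :: "('a, 'b) monoid_scheme \<Rightarrow> ('a \<Rightarrow> complex) \<Rightarrow> bool" where
  "positive_definite G \<phi> \<longleftrightarrow>
    (\<forall>n (g :: nat \<Rightarrow> 'a) (c :: nat \<Rightarrow> complex). (\<forall>i<n. g i \<in> carrier G) \<longrightarrow>
      (\<Sum>i<n. \<Sum>j<n. cnj (c i) * c j * \<phi> (inv\<^bsub>G\<^esub> (g i) \<otimes>\<^bsub>G\<^esub> g j)) \<in> \<real>\<^sub>\<ge>\<^sub>0)"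

text \<open>A function on the group is represented by a total function whose values outside the
  carrier are irrelevant.\<close>

definition normalized_pd :: "('a, 'b) monoid_scheme \<Rightarrow> 'a topology \<Rightarrow> ('a \<Rightarrow> complex) \<Rightarrow> bool" where
  "normalized_pd G T \<phi> \<longleftrightarrow>
    continuous_map T euclidean \<phi> \<and> \<phi> \<one>\<^bsub>G\<^esub> = 1 \<and> positive_definite G \<phi>"

text \<open>\<open>(i, j) \<in> r\<close> means that \<open>i\<close> precedes \<open>j\<close>.\<close>

definition directed_set :: "'i set \<Rightarrow> 'i rel \<Rightarrow> bool" where
  "directed_set I r \<longleftrightarrow> I \<noteq> {} \<and> preorder_on I r \<and> (\<forall>i\<in>I. \<forall>j\<in>I. \<exists>k\<in>I. (i, k) \<in> r \<and> (j, k) \<in> r)"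

definition tail_filter :: "'i set \<Rightarrow> 'i rel \<Rightarrow> 'i filter" where
  "tail_filter I r = (INF i\<in>I. principal {j \<in> I. (i, j) \<in> r})"

lemma eventually_tail_filter:
  assumes "directed_set I r"
  shows "eventually P (tail_filter I r) \<longleftrightarrow> (\<exists>i\<in>I. \<forall>j\<in>I. (i, j) \<in> r \<longrightarrow> P j)"
proof -
  have tr: "trans r" and ne: "I \<noteq> {}"
    and dir: "\<And>i j. i \<in> I \<Longrightarrow> j \<in> I \<Longrightarrow> \<exists>k\<in>I. (i, k) \<in> r \<and> (j, k) \<in> r"
    using assms by (auto simp: directed_set_def preorder_on_def)
  have "eventually P (tail_filter I r) \<longleftrightarrow>
      (\<exists>i\<in>I. eventually P (principal {j \<in> I. (i, j) \<in> r}))"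
    unfolding tail_filter_def
  proof (rule eventually_INF_base[OF ne])
    fix a b assume "a \<in> I" "b \<in> I"
    then obtain k where k: "k \<in> I" "(a, k) \<in> r" "(b, k) \<in> r"
      using dir by blast
    have "{j \<in> I. (k, j) \<in> r} \<subseteq> {j \<in> I. (a, j) \<in> r} \<inter> {j \<in> I. (b, j) \<in> r}"
      using k tr by (auto dest: transD)
    then show "\<exists>x\<in>I. principal {j \<in> I. (x, j) \<in> r}
        \<le> inf (principal {j \<in> I. (a, j) \<in> r}) (principal {j \<in> I. (b, j) \<in> r})"
      using k(1) by auto
  qed
  then show ?thesis by (auto simp: eventually_principal)
qed

text \<open>The defining condition of relative Property (T), for nets indexed by directed subsets of
  the type \<open>'i\<close>.\<close>

definition relative_property_T_for ::
  "'i itself \<Rightarrow> ('a, 'b) monoid_scheme \<Rightarrow> 'a topology \<Rightarrow> 'a set \<Rightarrow> bool" where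
  "relative_property_T_for _ G T X \<longleftrightarrow>
    (\<forall>(I :: 'i set) r (\<phi> :: 'i \<Rightarrow> 'a \<Rightarrow> complex).
      directed_set I r \<longrightarrow>
      (\<forall>i\<in>I. normalized_pd G T (\<phi> i)) \<longrightarrow>
      (\<forall>K. compactin T K \<longrightarrow> uniform_limit K \<phi> (\<lambda>_. 1) (tail_filter I r)) \<longrightarrow>
      uniform_limit X \<phi> (\<lambda>_. 1) (tail_filter I r))"

text \<open>A definition cannot quantify over the type of indices. The type \<open>'a set \<times> real\<close>, which
  accommodates the pairs of a compact set and a tolerance, is large enough: the condition for it
  implies the condition for every index type, as shown in \<open>relative_property_T_imp_for\<close>.\<close>

definition relative_property_T ::
  "('a, 'b) monoid_scheme \<Rightarrow> 'a topology \<Rightarrow> 'a set \<Rightarrow> bool" where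
  "relative_property_T G T X \<longleftrightarrow> relative_property_T_for TYPE('a set \<times> real) G T X"

lemma relative_property_T_imp_for:
  fixes G :: "('a, 'b) monoid_scheme"
  assumes "relative_property_T G T X"
  shows "relative_property_T_for TYPE('i) G T X"
  unfolding relative_property_T_for_def
proof (intro allI impI)
  fix I :: "'i set" and r and \<phi> :: "'i \<Rightarrow> 'a \<Rightarrow> complex"
  assume dir: "directed_set I r" and pd: "\<forall>i\<in>I. normalized_pd G T (\<phi> i)"
    and lim: "\<forall>K. compactin T K \<longrightarrow> uniform_limit K \<phi> (\<lambda>_. 1) (tail_filter I r)"
  show "uniform_limit X \<phi> (\<lambda>_. 1) (tail_filter I r)"
  proof (rule ccontr)
    assume "\<not> ?thesis"
    then obtain d where d: "d > 0"
      and bad: "\<And>i. i \<in> I \<Longrightarrow> \<exists>j\<in>I. (i, j) \<in> r \<and> \<not> (\<forall>x\<in>X. dist (\<phi> j x) 1 < d)"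
      unfolding uniform_limit_iff eventually_tail_filter[OF dir] by meson
    define J where "J = {(K, e :: real). compactin T K \<and> e > 0}"
    define s where "s = {(p, q). p \<in> J \<and> q \<in> J \<and> fst p \<subseteq> fst q \<and> snd q \<le> snd p}"
    have dirJ: "directed_set J s"
      unfolding directed_set_def
    proof (intro conjI ballI)
      show "J \<noteq> {}"
        by (auto simp: J_def intro!: exI[of _ "{}"] exI[of _ 1])
      show "preorder_on J s"
        by (auto simp: preorder_on_def refl_on_def trans_def s_def)
      fix p q assume pq: "p \<in> J" "q \<in> J"
      define k where "k = (fst p \<union> fst q, min (snd p) (snd q))"
      have "k \<in> J"
        using pq by (auto simp: k_def J_def intro: compactin_Un)
      then show "\<exists>k\<in>J. (p, k) \<in> s \<and> (q, k) \<in> s"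
        using pq by (intro bexI[of _ k]) (auto simp: s_def k_def)
    qed
    have "\<exists>j\<in>I. (\<forall>x\<in>fst p. dist (\<phi> j x) 1 < snd p) \<and> \<not> (\<forall>x\<in>X. dist (\<phi> j x) 1 < d)"
      if "p \<in> J" for p
    proof -
      have "uniform_limit (fst p) \<phi> (\<lambda>_. 1) (tail_filter I r)" "snd p > 0"
        using lim that by (auto simp: J_def)
      then obtain i where "i \<in> I" "\<forall>j\<in>I. (i, j) \<in> r \<longrightarrow> (\<forall>x\<in>fst p. dist (\<phi> j x) 1 < snd p)"
        unfolding uniform_limit_iff eventually_tail_filter[OF dir] by blast
      then show ?thesis using bad[of i] by blast
    qed
    then obtain f where f: "\<And>p. p \<in> J \<Longrightarrow> f p \<in> I"
        "\<And>p x. p \<in> J \<Longrightarrow> x \<in> fst p \<Longrightarrow> dist (\<phi> (f p) x) 1 < snd p"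
        "\<And>p. p \<in> J \<Longrightarrow> \<not> (\<forall>x\<in>X. dist (\<phi> (f p) x) 1 < d)"
      by metis
    have "uniform_limit K (\<lambda>p. \<phi> (f p)) (\<lambda>_. 1) (tail_filter J s)" if "compactin T K" for K
      unfolding uniform_limit_iff eventually_tail_filter[OF dirJ]
    proof (intro allI impI)
      fix e :: real assume "e > 0"
      then have "(K, e) \<in> J" using that by (simp add: J_def)
      moreover have "dist (\<phi> (f q) x) 1 < e" if "q \<in> J" "((K, e), q) \<in> s" "x \<in> K" for q x
        using f(2)[of q x] that by (auto simp: s_def)
      ultimately show "\<exists>p\<in>J. \<forall>q\<in>J. (p, q) \<in> s \<longrightarrow> (\<forall>x\<in>K. dist (\<phi> (f q) x) 1 < e)"
        by blast
    qed
    moreover have "\<forall>p\<in>J. normalized_pd G T (\<phi> (f p))"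
      using pd f(1) by blast
    ultimately have "uniform_limit X (\<lambda>p. \<phi> (f p)) (\<lambda>_. 1) (tail_filter J s)"
      using assms[unfolded relative_property_T_def relative_property_T_for_def,
          rule_format, of J s "\<lambda>p. \<phi> (f p)"] dirJ by blast
    then obtain p where "p \<in> J" "\<forall>q\<in>J. (p, q) \<in> s \<longrightarrow> (\<forall>x\<in>X. dist (\<phi> (f q) x) 1 < d)"
      using d unfolding uniform_limit_iff eventually_tail_filter[OF dirJ] by blast
    moreover have "(p, p) \<in> s" using \<open>p \<in> J\<close> by (simp add: s_def)
    ultimately show False using f(3) by blast
  qed
qed

end

theory Submission
  imports Defs
begin

text \<open>Relative Property (T) says that for every \<open>d > 0\<close> there are a compact \<open>K\<close> and an \<open>e > 0\<close> such
  that \<open>\<phi>\<close> is \<open>d\<close>-close to \<open>1\<close> on \<open>X\<close> as soon as it is \<open>e\<close>-close to \<open>1\<close> on \<open>K\<close>. Take the pair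
  \<open>(K, e)\<close> for \<open>d = 1/2\<close> and an open compactly generated subgroup \<open>H\<close> containing \<open>K\<close>. Extension by
  zero turns positive definite functions on \<open>H\<close> into ones on \<open>G\<close>; applied to the constant \<open>1\<close> it
  gives \<open>X \<subseteq> H\<close>, and in general the condition on \<open>H\<close> for \<open>d = 1/2\<close>. Smaller \<open>d\<close> would need larger
  \<open>K\<close>, and hence larger \<open>H\<close>, but the case \<open>d = 1/2\<close> self-improves, because squares of positive
  definite functions are positive definite.\<close>

section \<open>Positive semidefinite matrices and the Schur product\<close>

definition psd_on :: "'i set \<Rightarrow> ('i \<Rightarrow> 'i \<Rightarrow> complex) \<Rightarrow> bool" where
  "psd_on S A \<longleftrightarrow> (\<forall>c. (\<Sum>i\<in>S. \<Sum>j\<in>S. cnj (c i) * c j * A i j) \<in> \<real>\<^sub>\<ge>\<^sub>0)"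

lemma psd_onD: "psd_on S A \<Longrightarrow> (\<Sum>i\<in>S. \<Sum>j\<in>S. cnj (c i) * c j * A i j) \<in> \<real>\<^sub>\<ge>\<^sub>0"
  by (simp add: psd_on_def)

lemma sum_nonneg_Reals: "(\<And>x. x \<in> S \<Longrightarrow> f x \<in> \<real>\<^sub>\<ge>\<^sub>0) \<Longrightarrow> sum f S \<in> \<real>\<^sub>\<ge>\<^sub>0"
  for f :: "'i \<Rightarrow> complex"
  by (induction S rule: infinite_finite_induct) auto

lemma sum_sum_mono_neutral:
  fixes f :: "'i \<Rightarrow> 'i \<Rightarrow> 'c::comm_monoid_add"
  assumes "finite T" "S \<subseteq> T" and "\<And>i j. i \<in> T \<Longrightarrow> j \<in> T \<Longrightarrow> i \<notin> S \<or> j \<notin> S \<Longrightarrow> f i j = 0"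
  shows "(\<Sum>i\<in>T. \<Sum>j\<in>T. f i j) = (\<Sum>i\<in>S. \<Sum>j\<in>S. f i j)"
proof -
  have "(\<Sum>i\<in>T. \<Sum>j\<in>T. f i j) = (\<Sum>i\<in>S. \<Sum>j\<in>T. f i j)"
    using assms by (intro sum.mono_neutral_right) (auto intro!: sum.neutral)
  also have "\<dots> = (\<Sum>i\<in>S. \<Sum>j\<in>S. f i j)"
    using assms by (intro sum.cong refl sum.mono_neutral_right) auto
  finally show ?thesis .
qed

text \<open>Coefficients on \<open>S\<close> extend to \<open>T\<close> by zero. Index sets are
  arbitrary, rather than initial segments of the naturals, so that the induction in
  \<open>psd_on_mult\<close> can add one index at a time.\<close>

lemma psd_on_subset:
  assumes "psd_on T A" "finite T" "S \<subseteq> T"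
  shows "psd_on S A"
  unfolding psd_on_def
proof
  fix c :: "'a \<Rightarrow> complex"
  define d where "d i = (if i \<in> S then c i else 0)" for i
  have "(\<Sum>i\<in>T. \<Sum>j\<in>T. cnj (d i) * d j * A i j) = (\<Sum>i\<in>S. \<Sum>j\<in>S. cnj (d i) * d j * A i j)"
    using assms by (intro sum_sum_mono_neutral) (auto simp: d_def)
  also have "\<dots> = (\<Sum>i\<in>S. \<Sum>j\<in>S. cnj (c i) * c j * A i j)"
    by (intro sum.cong) (auto simp: d_def)
  finally show "(\<Sum>i\<in>S. \<Sum>j\<in>S. cnj (c i) * c j * A i j) \<in> \<real>\<^sub>\<ge>\<^sub>0"
    using psd_onD[OF assms(1), of d] by simp
qed

lemma psd_on_diagonal:
  assumes "psd_on T A" "finite T" "i \<in> T"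
  shows "A i i \<in> \<real>\<^sub>\<ge>\<^sub>0"
  using psd_onD[OF psd_on_subset[of T A "{i}"], of "\<lambda>_. 1"] assms by simp

lemma psd_on_pair:
  assumes "psd_on T A" "finite T" "i \<in> T" "j \<in> T" "i \<noteq> j"
  shows "cnj a * a * A i i + cnj a * b * A i j + cnj b * a * A j i + cnj b * b * A j j \<in> \<real>\<^sub>\<ge>\<^sub>0"
  using psd_onD[OF psd_on_subset[of T A "{i,j}"], of "(\<lambda>_. b)(i := a)"] assms
  by (simp add: add_ac)

text \<open>The quadratic form is real at the coefficient pairs \<open>(1, 1)\<close> and
  \<open>(1, \<i>)\<close>. As the diagonal is real, the first makes the imaginary parts of
  \<open>A i j\<close> and \<open>A j i\<close> opposite, the second makes their real parts
  equal.\<close>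

lemma psd_on_hermitian:
  assumes "psd_on T A" "finite T" "i \<in> T" "j \<in> T"
  shows "A j i = cnj (A i j)"
proof (cases "i = j")
  case True
  then show ?thesis
    using psd_on_diagonal[OF assms(1-3)] by (auto simp: complex_eq_iff complex_nonneg_Reals_iff)
next
  case False
  note D = psd_on_diagonal[OF assms(1-3)] psd_on_diagonal[OF assms(1,2,4)]
  note P = psd_on_pair[OF assms False]
  show ?thesis
    using D P[of 1 1] P[of 1 "\<i>"] by (simp add: complex_eq_iff complex_nonneg_Reals_iff)
qed

text \<open>If \<open>A i i = 0\<close>, the form is affine in the coefficient of \<open>i\<close>,
  so it stays nonnegative only if its linear part vanishes.\<close>

lemma psd_on_diagonal_zero:
  assumes "psd_on T A" "finite T" "i \<in> T" "j \<in> T" "A i i = 0"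
  shows "A i j = 0"
proof (cases "i = j")
  case False
  define r where "r = Re (A j j)"
  define m where "m = Re (A i j) * Re (A i j) + Im (A i j) * Im (A i j)"
  \<comment> \<open>The coefficient \<open>- t * A i j\<close> aligns the phases: each of the two
    cross terms becomes \<open>- t * m\<close>, where \<open>m\<close> is the squared modulus of
    \<open>A i j\<close>.\<close>
  have bound: "2 * t * m \<le> r" for t
    using psd_on_pair[OF assms(1-4) False, of "- of_real t * A i j" 1] assms(5)
      psd_on_hermitian[OF assms(1-4)]
    by (simp add: complex_nonneg_Reals_iff r_def m_def algebra_simps)
  have "m = 0"
  proof (rule ccontr)
    assume "m \<noteq> 0"
    then show False using bound[of "(r + 1) / (2 * m)"] by simp
  qed
  then show ?thesis by (simp add: m_def complex_eq_iff)
qed (use assms in simp)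

text \<open>The Schur product theorem, by splitting off from \<open>B\<close> the rank one matrix with the same row
  and column \<open>s\<close>; the remainder (the Schur complement) is supported on the smaller index set.\<close>

lemma psd_on_mult:
  assumes "finite S" "psd_on S A" "psd_on S B"
  shows "psd_on S (\<lambda>i j. A i j * B i j)"
  using assms
proof (induction S arbitrary: B rule: finite_induct)
  case empty
  then show ?case by (simp add: psd_on_def)
next
  case (insert s S)
  let ?T = "insert s S"
  have fin: "finite ?T" using insert by simp
  have AS: "psd_on S A" and BS: "psd_on S B"
    using insert.prems fin by (auto intro: psd_on_subset)
  have herm: "B i s = cnj (B s i)" if "i \<in> ?T" for i
    using psd_on_hermitian[OF insert.prems(2) fin, of s i] that by simp
  show ?case
  proof (cases "B s s = 0")
    \<comment> \<open>A zero pivot forces the whole row and column of \<open>s\<close> in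
      \<open>B\<close> to vanish, so only indices in \<open>S\<close> contribute.\<close>
    case True
    have row: "B s i = 0" "B i s = 0" if "i \<in> ?T" for i
      using psd_on_diagonal_zero[OF insert.prems(2) fin _ that True] herm[OF that] by simp_all
    have "psd_on S (\<lambda>i j. A i j * B i j)"
      using insert.IH AS BS .
    moreover have "(\<Sum>i\<in>?T. \<Sum>j\<in>?T. cnj (c i) * c j * (A i j * B i j)) =
        (\<Sum>i\<in>S. \<Sum>j\<in>S. cnj (c i) * c j * (A i j * B i j))" for c
      using fin row by (intro sum_sum_mono_neutral) auto
    ultimately show ?thesis by (simp add: psd_on_def)
  next
    case False
    define \<beta> where "\<beta> = B s s"
    have \<beta>: "\<beta> \<in> \<real>\<^sub>\<ge>\<^sub>0" "\<beta> \<noteq> 0" "cnj \<beta> = \<beta>"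
      using psd_on_diagonal[OF insert.prems(2) fin, of s] False herm[of s] by (simp_all add: \<beta>_def)
    have inv\<beta>: "inverse \<beta> \<in> \<real>\<^sub>\<ge>\<^sub>0"
      using \<beta>(1) by (auto simp: nonneg_Reals_def simp flip: of_real_inverse)
    define B' where "B' i j = B i j - cnj (B s i) * B s j / \<beta>" for i j
    have "psd_on S B'"
      unfolding psd_on_def
    proof
      fix c :: "'a \<Rightarrow> complex"
      define L where "L = (\<Sum>j\<in>S. c j * B s j)"
      \<comment> \<open>The value at \<open>s\<close> completes the square: with it, the form of
        \<open>B\<close> at \<open>d\<close> equals the form of the Schur complement
        \<open>B'\<close> at \<open>c\<close>.\<close>
      define d where "d = c(s := - L / \<beta>)"
      define F where "F = (\<Sum>i\<in>S. \<Sum>j\<in>S. cnj (c i) * c j * B i j)"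
      have dS: "d i = c i" if "i \<in> S" for i using that insert.hyps by (auto simp: d_def)
      have ds: "d s = - L / \<beta>" by (simp add: d_def)
      have r: "(\<Sum>j\<in>S. cnj (d s) * d j * B s j) = cnj (d s) * L"
        unfolding L_def sum_distrib_left by (intro sum.cong) (auto simp: dS)
      have l: "(\<Sum>i\<in>S. cnj (d i) * d s * B i s) = d s * cnj L"
        unfolding L_def cnj_sum sum_distrib_left by (intro sum.cong) (auto simp: dS herm)
      have FS: "(\<Sum>i\<in>S. \<Sum>j\<in>S. cnj (d i) * d j * B i j) = F"
        unfolding F_def by (intro sum.cong) (auto simp: dS)
      have "(\<Sum>i\<in>?T. \<Sum>j\<in>?T. cnj (d i) * d j * B i j) =
          cnj (d s) * d s * B s s + cnj (d s) * L + d s * cnj L + F"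
        using insert.hyps by (simp add: sum.distrib r l FS)
      also have "\<dots> = F - cnj L * L / \<beta>"
        using \<beta> by (simp add: ds field_simps flip: \<beta>_def)
      also have "\<dots> = (\<Sum>i\<in>S. \<Sum>j\<in>S. cnj (c i) * c j * B' i j)"
      proof -
        have "cnj L * L / \<beta> = (\<Sum>i\<in>S. \<Sum>j\<in>S. cnj (c i) * c j * (cnj (B s i) * B s j / \<beta>))"
          unfolding L_def cnj_sum sum_product sum_divide_distrib
          by (intro sum.cong) auto
        then show ?thesis
          by (simp add: F_def B'_def right_diff_distrib sum_subtractf)
      qed
      finally show "(\<Sum>i\<in>S. \<Sum>j\<in>S. cnj (c i) * c j * B' i j) \<in> \<real>\<^sub>\<ge>\<^sub>0"
        using psd_onD[OF insert.prems(2), of d] by simp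
    qed
    then have AB': "psd_on S (\<lambda>i j. A i j * B' i j)"
      using insert.IH AS by blast
    have row: "B' s i = 0" "B' i s = 0" if "i \<in> ?T" for i
      using herm[OF that] \<beta>(2,3) by (simp_all add: B'_def flip: \<beta>_def)
    show ?thesis
      unfolding psd_on_def
    proof
      fix c :: "'a \<Rightarrow> complex"
      \<comment> \<open>The product of \<open>A\<close> with the rank one part of \<open>B\<close>
        has at \<open>c\<close> the value of the form of \<open>A\<close> at the rescaled vector
        \<open>e\<close>, divided by \<open>\<beta>\<close>.\<close>
      define e where "e i = c i * B s i" for i
      have "(\<Sum>i\<in>?T. \<Sum>j\<in>?T. cnj (c i) * c j * (A i j * B i j)) =
          (\<Sum>i\<in>?T. \<Sum>j\<in>?T. cnj (e i) * e j * A i j * inverse \<beta> + cnj (c i) * c j * (A i j * B' i j))"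
        by (intro sum.cong) (auto simp: e_def B'_def field_simps \<beta>)
      also have "\<dots> = (\<Sum>i\<in>?T. \<Sum>j\<in>?T. cnj (e i) * e j * A i j) * inverse \<beta> +
          (\<Sum>i\<in>?T. \<Sum>j\<in>?T. cnj (c i) * c j * (A i j * B' i j))"
        unfolding sum_distrib_right sum.distrib ..
      also have "(\<Sum>i\<in>?T. \<Sum>j\<in>?T. cnj (c i) * c j * (A i j * B' i j)) =
          (\<Sum>i\<in>S. \<Sum>j\<in>S. cnj (c i) * c j * (A i j * B' i j))"
        using fin row by (intro sum_sum_mono_neutral) auto
      finally show "(\<Sum>i\<in>?T. \<Sum>j\<in>?T. cnj (c i) * c j * (A i j * B i j)) \<in> \<real>\<^sub>\<ge>\<^sub>0"
        using psd_onD[OF insert.prems(1), of e] psd_onD[OF AB', of c] inv\<beta> by simp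
    qed
  qed
qed

section \<open>Positive definite functions on groups and subgroups\<close>

lemma positive_definite_iff_psd_on:
  "positive_definite G \<phi> \<longleftrightarrow>
    (\<forall>n g. (\<forall>i<n. g i \<in> carrier G) \<longrightarrow>
      psd_on {..<n::nat} (\<lambda>i j. \<phi> (inv\<^bsub>G\<^esub> (g i) \<otimes>\<^bsub>G\<^esub> g j)))"
  by (auto simp: positive_definite_def psd_on_def)

lemma positive_definite_mult:
  "positive_definite G \<phi> \<Longrightarrow> positive_definite G \<psi> \<Longrightarrow> positive_definite G (\<lambda>x. \<phi> x * \<psi> x)"
  unfolding positive_definite_iff_psd_on by (auto intro!: psd_on_mult)

lemma positive_definite_one: "positive_definite G (\<lambda>_. 1)"
  unfolding positive_definite_def
proof (intro allI impI)
  fix n :: nat and g :: "nat \<Rightarrow> 'a" and c :: "nat \<Rightarrow> complex"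
  have "(\<Sum>i<n. \<Sum>j<n. cnj (c i) * c j * 1) = cnj (sum c {..<n}) * sum c {..<n}"
    by (simp add: sum_product)
  also have "\<dots> = of_real ((cmod (sum c {..<n}))\<^sup>2)"
    by (simp only: complex_norm_square mult.commute)
  also have "\<dots> \<in> \<real>\<^sub>\<ge>\<^sub>0"
    by (subst nonneg_Reals_of_real_iff) simp
  finally show "(\<Sum>i<n. \<Sum>j<n. cnj (c i) * c j * 1) \<in> \<real>\<^sub>\<ge>\<^sub>0" .
qed

context group
begin

lemma positive_definite_subgroup:
  assumes "subgroup H G" "positive_definite G \<phi>"
  shows "positive_definite (G\<lparr>carrier := H\<rparr>) \<phi>"
  unfolding positive_definite_def
proof (intro allI impI)
  fix n :: nat and g :: "nat \<Rightarrow> 'a" and c :: "nat \<Rightarrow> complex"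
  assume "\<forall>i<n. g i \<in> carrier (G\<lparr>carrier := H\<rparr>)"
  then have g: "\<And>i. i < n \<Longrightarrow> g i \<in> H" by simp
  then have "(\<Sum>i<n. \<Sum>j<n. cnj (c i) * c j * \<phi> (inv (g i) \<otimes> g j)) \<in> \<real>\<^sub>\<ge>\<^sub>0"
    using assms(2) subgroup.mem_carrier[OF assms(1)] unfolding positive_definite_def by blast
  then show "(\<Sum>i<n. \<Sum>j<n. cnj (c i) * c j *
      \<phi> (inv\<^bsub>G\<lparr>carrier := H\<rparr>\<^esub> (g i) \<otimes>\<^bsub>G\<lparr>carrier := H\<rparr>\<^esub> g j)) \<in> \<real>\<^sub>\<ge>\<^sub>0"
    using g by (simp add: m_inv_consistent[OF assms(1)])
qed

text \<open>The quadratic form of the extension is the sum, over the left cosets of \<open>H\<close>, of quadratic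
  forms of \<open>\<phi>\<close>.\<close>

lemma positive_definite_extension:
  assumes H: "subgroup H G" and pd: "positive_definite (G\<lparr>carrier := H\<rparr>) \<phi>"
  shows "positive_definite G (\<lambda>x. if x \<in> H then \<phi> x else 0)"
  unfolding positive_definite_def
proof (intro allI impI)
  fix n :: nat and g :: "nat \<Rightarrow> 'a" and c :: "nat \<Rightarrow> complex"
  assume "\<forall>i<n. g i \<in> carrier G"
  then have g: "\<And>i. i < n \<Longrightarrow> g i \<in> carrier G" by simp
  define \<psi> where "\<psi> x = (if x \<in> H then \<phi> x else 0)" for x
  define R where "R = (\<lambda>i. g i <# H) ` {..<n}"
  define a where "a C = (SOME i. i < n \<and> g i <# H = C)" for C
  \<comment> \<open>Dividing by the representative \<open>g (a C)\<close> moves the points of the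
    coset \<open>C\<close> into \<open>H\<close> without changing the quotients
    \<open>inv (g i) \<otimes> g j\<close>. Points outside \<open>C\<close> get the placeholder
    \<open>\<one>\<close>, which lies in \<open>H\<close>, and the coefficient zero in
    \<open>d\<close>.\<close>
  define h where "h C i = (if g i <# H = C then inv (g (a C)) \<otimes> g i else \<one>)" for C i
  define d where "d C i = (if g i <# H = C then c i else 0)" for C i
  have a: "a C < n" "g (a C) <# H = C" if "C \<in> R" for C
  proof -
    have "\<exists>i. i < n \<and> g i <# H = C" using that by (auto simp: R_def)
    then have "a C < n \<and> g (a C) <# H = C" unfolding a_def by (rule someI_ex)
    then show "a C < n" "g (a C) <# H = C" by auto
  qed
  have coset: "g i <# H = g j <# H \<longleftrightarrow> inv (g i) \<otimes> g j \<in> H" if "i < n" "j < n" for i j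
  proof
    assume "g i <# H = g j <# H"
    moreover have "g j \<in> g j <# H"
      using g[OF that(2)] subgroup.one_closed[OF H] by (force simp: l_coset_def)
    ultimately obtain x where "x \<in> H" "g j = g i \<otimes> x" by (auto simp: l_coset_def)
    then show "inv (g i) \<otimes> g j \<in> H"
      using g[OF that(1)] subgroup.mem_carrier[OF H] by (simp flip: m_assoc)
  next
    assume "inv (g i) \<otimes> g j \<in> H"
    then have "g j \<in> g i <# H"
      using g that by (auto simp: l_coset_def intro!: bexI[of _ "inv (g i) \<otimes> g j"] simp flip: m_assoc)
    then show "g i <# H = g j <# H"
      using g that H l_repr_independence by blast
  qed
  have hH: "h C i \<in> H" if "C \<in> R" "i < n" for C i
    using a[OF that(1)] coset[of "a C" i] that subgroup.one_closed[OF H] by (auto simp: h_def)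
  \<comment> \<open>Only the coset of \<open>g i\<close> can contribute. If \<open>g j\<close> lies
    in another coset, \<open>d\<close> vanishes on the left and \<open>\<psi>\<close> on the
    right.\<close>
  have summand: "(\<Sum>C\<in>R. cnj (d C i) * d C j * \<phi> (inv (h C i) \<otimes> h C j)) =
      cnj (c i) * c j * \<psi> (inv (g i) \<otimes> g j)" if ij: "i < n" "j < n" for i j
  proof -
    let ?C = "g i <# H"
    have C: "?C \<in> R" using ij by (auto simp: R_def)
    have "(\<Sum>C\<in>R. cnj (d C i) * d C j * \<phi> (inv (h C i) \<otimes> h C j)) =
        (\<Sum>C\<in>{?C}. cnj (d C i) * d C j * \<phi> (inv (h C i) \<otimes> h C j))"
      using C by (intro sum.mono_neutral_right) (auto simp: R_def d_def)
    also have "\<dots> = cnj (c i) * c j * \<psi> (inv (g i) \<otimes> g j)"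
    proof (cases "g i <# H = g j <# H")
      case True
      have G: "g (a ?C) \<in> carrier G" "g i \<in> carrier G" "g j \<in> carrier G"
        using a[OF C] g ij by auto
      then have "inv (inv (g (a ?C)) \<otimes> g i) \<otimes> (inv (g (a ?C)) \<otimes> g j) = inv (g i) \<otimes> g j"
        by (simp add: inv_mult_group m_assoc inv_solve_left')
          (metis G inv_closed m_closed m_assoc r_inv l_one)
      then show ?thesis
        using True coset[OF ij] by (simp add: d_def h_def \<psi>_def)
    next
      case False
      then show ?thesis using coset[OF ij] by (simp add: d_def \<psi>_def)
    qed
    finally show ?thesis .
  qed
  have "(\<Sum>i<n. \<Sum>j<n. cnj (c i) * c j * \<psi> (inv (g i) \<otimes> g j)) =
      (\<Sum>i<n. \<Sum>j<n. \<Sum>C\<in>R. cnj (d C i) * d C j * \<phi> (inv (h C i) \<otimes> h C j))"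
    by (intro sum.cong refl) (simp add: summand)
  also have "\<dots> = (\<Sum>i<n. \<Sum>C\<in>R. \<Sum>j<n. cnj (d C i) * d C j * \<phi> (inv (h C i) \<otimes> h C j))"
    by (intro sum.cong refl sum.swap)
  also have "\<dots> = (\<Sum>C\<in>R. \<Sum>i<n. \<Sum>j<n. cnj (d C i) * d C j * \<phi> (inv (h C i) \<otimes> h C j))"
    by (rule sum.swap)
  also have "\<dots> \<in> \<real>\<^sub>\<ge>\<^sub>0"
  proof (rule sum_nonneg_Reals)
    fix C assume "C \<in> R"
    then have hH: "\<And>i. i < n \<Longrightarrow> h C i \<in> H" using hH by blast
    then have "(\<Sum>i<n. \<Sum>j<n. cnj (d C i) * d C j *
        \<phi> (inv\<^bsub>G\<lparr>carrier := H\<rparr>\<^esub> (h C i) \<otimes>\<^bsub>G\<lparr>carrier := H\<rparr>\<^esub> h C j)) \<in> \<real>\<^sub>\<ge>\<^sub>0"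
      using pd by (simp add: positive_definite_def)
    then show "(\<Sum>i<n. \<Sum>j<n. cnj (d C i) * d C j * \<phi> (inv (h C i) \<otimes> h C j)) \<in> \<real>\<^sub>\<ge>\<^sub>0"
      using hH by (simp add: m_inv_consistent[OF H])
  qed
  finally show "(\<Sum>i<n. \<Sum>j<n. cnj (c i) * c j *
      (if inv (g i) \<otimes> g j \<in> H then \<phi> (inv (g i) \<otimes> g j) else 0)) \<in> \<real>\<^sub>\<ge>\<^sub>0"
    by (simp add: \<psi>_def)
qed

end

section \<open>Open subgroups and continuity of the extension by zero\<close>

context locally_compact_group
begin

lemma continuous_map_left_translation:
  assumes "a \<in> carrier G"
  shows "continuous_map T T (\<lambda>x. a \<otimes> x)"
proof -
  have "continuous_map T (prod_topology T T) (\<lambda>x. (a, x))"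
    using assms by (intro continuous_map_pairedI) (auto simp: topspace_eq_carrier)
  from continuous_map_compose[OF this continuous_mult] show ?thesis by (simp add: o_def)
qed

lemma openin_left_coset:
  assumes "openin T U" "a \<in> carrier G"
  shows "openin T (a <# U)"
proof -
  have U: "U \<subseteq> carrier G" using openin_subset[OF assms(1)] by (simp add: topspace_eq_carrier)
  have "a <# U = {x \<in> topspace T. inv a \<otimes> x \<in> U}"
    unfolding topspace_eq_carrier
  proof (intro equalityI subsetI)
    fix x assume "x \<in> {x \<in> carrier G. inv a \<otimes> x \<in> U}"
    moreover from this have "x = a \<otimes> (inv a \<otimes> x)"
      using assms(2) by (simp flip: m_assoc)
    ultimately show "x \<in> a <# U" by (auto simp: l_coset_def)
  qed (use assms(2) U in \<open>auto simp: l_coset_def m_assoc[symmetric] subsetD\<close>)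
  then show ?thesis
    using openin_continuous_map_preimage[OF continuous_map_left_translation assms(1)] assms(2) by simp
qed

text \<open>Around each of its points \<open>x\<close>, the subgroup contains the open translate of
  \<open>U\<close> by \<open>x\<close>.\<close>

lemma openin_subgroup:
  assumes H: "subgroup H G" and U: "openin T U" "\<one> \<in> U" "U \<subseteq> H"
  shows "openin T H"
proof (subst openin_subopen, intro ballI)
  fix x assume x: "x \<in> H"
  then have "x \<in> carrier G" using subgroup.mem_carrier[OF H] by blast
  then have "x \<in> x <# U" "openin T (x <# U)"
    using U openin_left_coset by (force simp: l_coset_def)+
  moreover have "x <# U \<subseteq> H"
    using x U(3) H by (auto simp: l_coset_def subgroup.m_closed)
  ultimately show "\<exists>V. openin T V \<and> x \<in> V \<and> V \<subseteq> H" by blast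
qed

text \<open>The left coset through a point outside \<open>H\<close> is open and misses
  \<open>H\<close>. So an open subgroup is also closed, which is what makes the extension by zero
  continuous.\<close>

lemma openin_subgroup_complement:
  assumes H: "subgroup H G" "openin T H"
  shows "openin T (carrier G - H)"
proof (subst openin_subopen, intro ballI)
  fix x assume x: "x \<in> carrier G - H"
  have "x \<in> x <# H"
    using x subgroup.one_closed[OF H(1)] by (force simp: l_coset_def)
  moreover have "x <# H \<subseteq> carrier G - H"
  proof (clarsimp simp: l_coset_def, intro conjI)
    fix h assume h: "h \<in> H"
    then have hG: "h \<in> carrier G" using subgroup.mem_carrier[OF H(1)] by blast
    then show "x \<otimes> h \<in> carrier G" using x by simp
    show "x \<otimes> h \<notin> H"
    proof
      assume "x \<otimes> h \<in> H"
      then have "(x \<otimes> h) \<otimes> inv h \<in> H"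
        using h H(1) by (simp add: subgroup.m_closed subgroup.m_inv_closed)
      then show False using x hG by (simp add: m_assoc)
    qed
  qed
  moreover have "openin T (x <# H)" using x H(2) by (intro openin_left_coset) auto
  ultimately show "\<exists>V. openin T V \<and> x \<in> V \<and> V \<subseteq> carrier G - H" by blast
qed

lemma normalized_pd_subgroup:
  assumes "subgroup H G" "normalized_pd G T \<phi>"
  shows "normalized_pd (G\<lparr>carrier := H\<rparr>) (subtopology T H) \<phi>"
  using assms by (auto simp: normalized_pd_def continuous_map_from_subtopology
      intro: positive_definite_subgroup)

lemma normalized_pd_extension:
  assumes H: "subgroup H G" "openin T H"
    and \<phi>: "normalized_pd (G\<lparr>carrier := H\<rparr>) (subtopology T H) \<phi>"
  shows "normalized_pd G T (\<lambda>x. if x \<in> H then \<phi> x else 0)"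
  unfolding normalized_pd_def
proof (intro conjI)
  have HG: "H \<subseteq> carrier G" using H(1) by (rule subgroup.subset)
  show "continuous_map T euclidean (\<lambda>x. if x \<in> H then \<phi> x else 0)"
    unfolding continuous_map_def
  proof (intro conjI allI impI)
    fix U :: "complex set" assume U: "openin euclidean U"
    have "openin (subtopology T H) {x \<in> topspace (subtopology T H). \<phi> x \<in> U}"
      using \<phi> U unfolding normalized_pd_def by (blast intro: openin_continuous_map_preimage)
    then have 1: "openin T {x \<in> topspace (subtopology T H). \<phi> x \<in> U}"
      using H(2) openin_open_subtopology by blast
    \<comment> \<open>The extension is constantly zero off \<open>H\<close>, so the complement lies
      in the preimage either entirely or not at all.\<close>
    have "{x \<in> topspace T. (if x \<in> H then \<phi> x else 0) \<in> U} =
        {x \<in> topspace (subtopology T H). \<phi> x \<in> U} \<union> (if 0 \<in> U then carrier G - H else {})"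
      using HG by (auto simp: topspace_eq_carrier)
    also have "openin T \<dots>"
      using 1 openin_subgroup_complement[OF H] by auto
    finally show "openin T {x \<in> topspace T. (if x \<in> H then \<phi> x else 0) \<in> U}" .
  qed simp
  show "(if \<one> \<in> H then \<phi> \<one> else 0) = 1"
    using \<phi> subgroup.one_closed[OF H(1)] by (simp add: normalized_pd_def)
  show "positive_definite G (\<lambda>x. if x \<in> H then \<phi> x else 0)"
    using \<phi> H(1) by (auto simp: normalized_pd_def intro: positive_definite_extension)
qed

end

section \<open>Relative Property (T) without nets, and its self-improvement\<close>

lemma normalized_pd_mult:
  assumes "normalized_pd G T \<phi>" "normalized_pd G T \<psi>"
  shows "normalized_pd G T (\<lambda>x. \<phi> x * \<psi> x)"
proof -
  have "continuous_map T euclidean (\<lambda>x. \<phi> x * \<psi> x)"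
    using assms by (simp add: normalized_pd_def continuous_map_atin tendsto_mult)
  then show ?thesis
    using assms by (simp add: normalized_pd_def positive_definite_mult)
qed

lemma normalized_pd_one: "normalized_pd G T (\<lambda>_. 1)"
  by (simp add: normalized_pd_def positive_definite_one)

text \<open>The condition for a single \<open>d\<close>. The set \<open>K\<close> stays explicit
  because the open subgroup is later chosen to contain it.\<close>

definition controls :: "('a, 'b) monoid_scheme \<Rightarrow> 'a topology \<Rightarrow> 'a set \<Rightarrow> 'a set \<Rightarrow> real \<Rightarrow> real \<Rightarrow> bool"
  where "controls G T X K e d \<longleftrightarrow>
    (\<forall>\<phi>. normalized_pd G T \<phi> \<longrightarrow> (\<forall>x\<in>K. dist (\<phi> x) 1 < e) \<longrightarrow> (\<forall>x\<in>X. dist (\<phi> x) 1 < d))"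

lemma controlsD:
  "controls G T X K e d \<Longrightarrow> normalized_pd G T \<phi> \<Longrightarrow> (\<And>x. x \<in> K \<Longrightarrow> dist (\<phi> x) 1 < e) \<Longrightarrow>
    x \<in> X \<Longrightarrow> dist (\<phi> x) 1 < d"
  by (auto simp: controls_def)

text \<open>If some \<open>d\<close> admits no pair \<open>(K, e)\<close>, choosing a bad function
  for every pair gives a net indexed by the pairs themselves, ordered by larger \<open>K\<close> and
  smaller \<open>e\<close>. It converges to \<open>1\<close> uniformly on compact sets but not on
  \<open>X\<close>.\<close>

lemma relative_property_T_iff_controls:
  "relative_property_T G T X \<longleftrightarrow> (\<forall>d>0. \<exists>K e. compactin T K \<and> e > 0 \<and> controls G T X K e d)"
proof
  assume rel: "relative_property_T G T X"
  show "\<forall>d>0. \<exists>K e. compactin T K \<and> e > 0 \<and> controls G T X K e d"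
  proof (rule ccontr)
    assume "\<not> ?thesis"
    then obtain d where d: "d > 0" and bad: "\<And>K e. compactin T K \<Longrightarrow> e > 0 \<Longrightarrow> \<not> controls G T X K e d"
      by blast
    define J where "J = {(K, e :: real). compactin T K \<and> e > 0}"
    define s where "s = {(p, q). p \<in> J \<and> q \<in> J \<and> fst p \<subseteq> fst q \<and> snd q \<le> snd p}"
    have dir: "directed_set J s"
      unfolding directed_set_def
    proof (intro conjI ballI)
      show "J \<noteq> {}"
        by (auto simp: J_def intro!: exI[of _ "{}"] exI[of _ 1])
      show "preorder_on J s"
        by (auto simp: preorder_on_def refl_on_def trans_def s_def)
      fix p q assume pq: "p \<in> J" "q \<in> J"
      then have "(fst p \<union> fst q, min (snd p) (snd q)) \<in> J"
        by (auto simp: J_def intro: compactin_Un)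
      then show "\<exists>k\<in>J. (p, k) \<in> s \<and> (q, k) \<in> s"
        using pq by (intro bexI) (auto simp: s_def)
    qed
    have "\<forall>p\<in>J. \<exists>\<phi>. normalized_pd G T \<phi> \<and> (\<forall>x\<in>fst p. dist (\<phi> x) 1 < snd p) \<and>
        \<not> (\<forall>x\<in>X. dist (\<phi> x) 1 < d)"
      using bad by (auto simp: J_def controls_def)
    then obtain \<phi> where \<phi>: "\<And>p. p \<in> J \<Longrightarrow> normalized_pd G T (\<phi> p)"
        "\<And>p x. p \<in> J \<Longrightarrow> x \<in> fst p \<Longrightarrow> dist (\<phi> p x) 1 < snd p"
        "\<And>p. p \<in> J \<Longrightarrow> \<not> (\<forall>x\<in>X. dist (\<phi> p x) 1 < d)"
      by metis
    have "uniform_limit K \<phi> (\<lambda>_. 1) (tail_filter J s)" if "compactin T K" for K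
      unfolding uniform_limit_iff eventually_tail_filter[OF dir]
    proof (intro allI impI)
      fix e :: real assume "e > 0"
      then have "(K, e) \<in> J" using that by (simp add: J_def)
      moreover have "dist (\<phi> q x) 1 < e" if "q \<in> J" "((K, e), q) \<in> s" "x \<in> K" for q x
        using \<phi>(2)[of q x] that by (auto simp: s_def)
      ultimately show "\<exists>p\<in>J. \<forall>q\<in>J. (p, q) \<in> s \<longrightarrow> (\<forall>x\<in>K. dist (\<phi> q x) 1 < e)"
        by blast
    qed
    then have "uniform_limit X \<phi> (\<lambda>_. 1) (tail_filter J s)"
      using rel[unfolded relative_property_T_def relative_property_T_for_def,
          rule_format, of J s \<phi>] dir \<phi>(1) by blast
    then obtain p where "p \<in> J" "\<forall>q\<in>J. (p, q) \<in> s \<longrightarrow> (\<forall>x\<in>X. dist (\<phi> q x) 1 < d)"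
      using d unfolding uniform_limit_iff eventually_tail_filter[OF dir] by blast
    \<comment> \<open>Reflexivity puts \<open>p\<close> in its own tail, against the choice of
      \<open>\<phi> p\<close>.\<close>
    moreover have "(p, p) \<in> s" using \<open>p \<in> J\<close> by (simp add: s_def)
    ultimately show False using \<phi>(3) by blast
  qed
next
  assume ctrl: "\<forall>d>0. \<exists>K e. compactin T K \<and> e > 0 \<and> controls G T X K e d"
  show "relative_property_T G T X"
    unfolding relative_property_T_def relative_property_T_for_def
  proof (intro allI impI)
    fix I :: "('a set \<times> real) set" and r and \<phi> :: "'a set \<times> real \<Rightarrow> 'a \<Rightarrow> complex"
    assume dir: "directed_set I r" and pd: "\<forall>i\<in>I. normalized_pd G T (\<phi> i)"
      and lim: "\<forall>K. compactin T K \<longrightarrow> uniform_limit K \<phi> (\<lambda>_. 1) (tail_filter I r)"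
    show "uniform_limit X \<phi> (\<lambda>_. 1) (tail_filter I r)"
      unfolding uniform_limit_iff eventually_tail_filter[OF dir]
    proof (intro allI impI)
      fix d :: real assume "d > 0"
      then obtain K e where K: "compactin T K" "e > 0" "controls G T X K e d"
        using ctrl by blast
      then obtain i where "i \<in> I" "\<forall>j\<in>I. (i, j) \<in> r \<longrightarrow> (\<forall>x\<in>K. dist (\<phi> j x) 1 < e)"
        using lim unfolding uniform_limit_iff eventually_tail_filter[OF dir] by blast
      then show "\<exists>i\<in>I. \<forall>j\<in>I. (i, j) \<in> r \<longrightarrow> (\<forall>x\<in>X. dist (\<phi> j x) 1 < d)"
        using K(3) pd by (intro bexI[of _ i]) (auto simp: controls_def)
    qed
  qed
qed

text \<open>If \<open>\<phi>\<close> is within \<open>1/2\<close> of \<open>1\<close>, then \<open>\<bar>\<phi> + 1\<bar> \<ge> 3/2\<close>, so control of \<open>\<phi>\<^sup>2 - 1\<close> improves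
  the control of \<open>\<phi> - 1\<close> by the factor \<open>2/3\<close>.\<close>

lemma controls_improve:
  assumes 1: "controls G T X K1 e1 (1/2)" "compactin T K1" "e1 > 0"
    and 2: "controls G T X K2 e2 d" "compactin T K2" "e2 > 0"
  shows "\<exists>K e. compactin T K \<and> e > 0 \<and> controls G T X K e (2/3 * d)"
proof (intro exI conjI)
  \<comment> \<open>The bound \<open>e1\<close> serves the first control. The bound \<open>1\<close>
    gives \<open>cmod (\<phi> y + 1) \<le> 3\<close> on \<open>K2\<close>, so \<open>e2 / 3\<close>
    makes the square of \<open>\<phi>\<close> \<open>e2\<close>-close to \<open>1\<close>
    there.\<close>
  let ?K = "K1 \<union> K2" and ?e = "min e1 (min 1 (e2 / 3))"
  show "compactin T ?K" "?e > 0" using assms by (auto intro: compactin_Un)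
  show "controls G T X ?K ?e (2/3 * d)"
    unfolding controls_def
  proof (intro allI impI ballI)
    fix \<phi> x assume \<phi>: "normalized_pd G T \<phi>" and near: "\<forall>x\<in>?K. dist (\<phi> x) 1 < ?e" and x: "x \<in> X"
    have fac: "dist (z * z) 1 = dist z 1 * cmod (z + 1)" for z :: complex
      by (simp add: dist_norm algebra_simps flip: norm_mult)
    have "dist (\<phi> y * \<phi> y) 1 < e2" if "y \<in> K2" for y
    proof -
      have y: "dist (\<phi> y) 1 < 1" "dist (\<phi> y) 1 < e2 / 3"
        using near that by auto
      have "cmod (\<phi> y + 1) \<le> cmod (\<phi> y - 1) + cmod 2"
        using norm_triangle_ineq[of "\<phi> y - 1" 2] by (simp add: add.commute)
      then have "cmod (\<phi> y + 1) \<le> 3" using y(1) by (simp add: dist_norm)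
      then have "dist (\<phi> y) 1 * cmod (\<phi> y + 1) \<le> dist (\<phi> y) 1 * 3"
        by (intro mult_left_mono) auto
      then show ?thesis using y(2) by (simp add: fac)
    qed
    then have sq: "dist (\<phi> x) 1 * cmod (\<phi> x + 1) < d"
      using controlsD[OF 2(1) normalized_pd_mult[OF \<phi> \<phi>] _ x] by (simp add: fac)
    have "dist (\<phi> x) 1 < 1/2"
      using controlsD[OF 1(1) \<phi> _ x] near by simp
    moreover have "cmod 2 \<le> cmod (\<phi> x + 1) + cmod (\<phi> x - 1)"
      using norm_triangle_ineq4[of "\<phi> x + 1" "\<phi> x - 1"] by simp
    ultimately have "3/2 \<le> cmod (\<phi> x + 1)" by (simp add: dist_norm)
    then have "dist (\<phi> x) 1 * (3/2) \<le> dist (\<phi> x) 1 * cmod (\<phi> x + 1)"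
      by (intro mult_left_mono) auto
    then show "dist (\<phi> x) 1 < 2/3 * d" using sq by simp
  qed
qed

text \<open>Apply \<open>controls_improve\<close> repeatedly, always with the given control at
  \<open>1/2\<close> as the first one: the tolerances \<open>(2/3) ^ n * (1/2)\<close> tend to
  zero.\<close>

lemma relative_property_T_if_controls_half:
  assumes "controls G T X K e (1/2)" "compactin T K" "e > 0"
  shows "relative_property_T G T X"
  unfolding relative_property_T_iff_controls
proof (intro allI impI)
  have ctrl: "\<exists>K e. compactin T K \<and> e > 0 \<and> controls G T X K e ((2/3) ^ n * (1/2))" for n
  proof (induction n)
    case 0
    then show ?case using assms by auto
  next
    case (Suc n)
    then obtain K' e' where "controls G T X K' e' ((2/3) ^ n * (1/2))" "compactin T K'" "e' > 0"
      by blast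
    from controls_improve[OF assms this] show ?case by (simp add: mult.assoc)
  qed
  fix d :: real assume "d > 0"
  then obtain n where "(2/3) ^ n < d"
    using real_arch_pow_inv[of d "2/3"] by auto
  moreover have "(2/3) ^ n * (1/2) \<le> (2/3 :: real) ^ n" by simp
  ultimately have "(2/3) ^ n * (1/2) < d" by linarith
  then show "\<exists>K e. compactin T K \<and> e > 0 \<and> controls G T X K e d"
    using ctrl[of n] unfolding controls_def by (meson less_trans)
qed

section \<open>Passing between the group and its open subgroups\<close>

context locally_compact_group
begin

text \<open>The subgroup is generated by \<open>K\<close> together with a compact neighbourhood
  \<open>V\<close> of the identity; the latter makes it open.\<close>

lemma compact_in_open_compactly_generated_subgroup:
  assumes "compactin T K"
  obtains H where "subgroup H G" "openin T H" "K \<subseteq> H"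
    "compactly_generated (G\<lparr>carrier := H\<rparr>) (subtopology T H)"
proof -
  obtain U V where UV: "openin T U" "compactin T V" "\<one> \<in> U" "U \<subseteq> V"
    using locally_compact one_closed unfolding locally_compact_space_def topspace_eq_carrier by blast
  define H where "H = generate G (K \<union> V)"
  have KV: "compactin T (K \<union> V)" using assms UV by (simp add: compactin_Un)
  then have sub: "K \<union> V \<subseteq> carrier G"
    using compactin_subset_topspace topspace_eq_carrier by blast
  have KVH: "K \<union> V \<subseteq> H"
    unfolding H_def using generate.incl by (rule subsetI)
  have H: "subgroup H G"
    unfolding H_def using sub by (rule generate_is_subgroup)
  moreover have "openin T H"
    using openin_subgroup[OF H UV(1,3)] UV(4) KVH by blast
  moreover have "compactly_generated (G\<lparr>carrier := H\<rparr>) (subtopology T H)"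
    unfolding compactly_generated_def
    using KV KVH generate_consistent[OF KVH H]
    by (intro exI[of _ "K \<union> V"]) (auto simp: compactin_subtopology H_def)
  ultimately show thesis using that KVH by blast
qed

text \<open>Normalized positive definite functions on \<open>G\<close> restrict to \<open>H\<close>,
  and a compact subset of \<open>H\<close> is compact in \<open>G\<close>, so the same
  \<open>K\<close> and \<open>e\<close> serve.\<close>

lemma relative_property_T_if_subgroup:
  assumes "subgroup H G" "relative_property_T (G\<lparr>carrier := H\<rparr>) (subtopology T H) X"
  shows "relative_property_T G T X"
  unfolding relative_property_T_iff_controls
proof (intro allI impI)
  fix d :: real assume "d > 0"
  then obtain K e where "compactin (subtopology T H) K" "e > 0"
      "controls (G\<lparr>carrier := H\<rparr>) (subtopology T H) X K e d"
    using assms(2) unfolding relative_property_T_iff_controls by blast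
  then show "\<exists>K e. compactin T K \<and> e > 0 \<and> controls G T X K e d"
    using normalized_pd_subgroup[OF assms(1)] unfolding controls_def compactin_subtopology by meson
qed

text \<open>The extension by zero agrees with \<open>\<phi>\<close> on \<open>K\<close>, since
  \<open>K \<subseteq> H\<close>, so the control on \<open>G\<close> applies to it.\<close>

lemma controls_open_subgroup:
  assumes H: "subgroup H G" "openin T H" and "K \<subseteq> H"
    and ctrl: "controls G T X K e d" and e: "e > 0" and d: "d \<le> 1"
  shows "X \<subseteq> H" "controls (G\<lparr>carrier := H\<rparr>) (subtopology T H) X K e d"
proof -
  have near: "dist (if x \<in> H then \<phi> x else 0) 1 < d"
    if "normalized_pd (G\<lparr>carrier := H\<rparr>) (subtopology T H) \<phi>"
      "\<And>x. x \<in> K \<Longrightarrow> dist (\<phi> x) 1 < e" "x \<in> X" for \<phi> x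
  proof (rule controlsD[OF ctrl normalized_pd_extension[OF H that(1)] _ that(3)])
    show "dist (if y \<in> H then \<phi> y else 0) 1 < e" if "y \<in> K" for y
      using that \<open>K \<subseteq> H\<close> \<open>\<And>x. x \<in> K \<Longrightarrow> dist (\<phi> x) 1 < e\<close> by auto
  qed
  show XH: "X \<subseteq> H"
  proof
    fix x assume "x \<in> X"
    then have "dist (if x \<in> H then 1 else 0 :: complex) 1 < d"
      using near[OF normalized_pd_one] e by simp
    \<comment> \<open>Off \<open>H\<close> the extension of the constant \<open>1\<close> has the
      value \<open>0\<close>, at distance \<open>1\<close> from \<open>1\<close>, which
      \<open>d \<le> 1\<close> excludes.\<close>
    then show "x \<in> H" using d by (auto split: if_splits)
  qed
  show "controls (G\<lparr>carrier := H\<rparr>) (subtopology T H) X K e d"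
    unfolding controls_def
  proof (intro allI impI ballI)
    fix \<phi> x assume "normalized_pd (G\<lparr>carrier := H\<rparr>) (subtopology T H) \<phi>"
      "\<forall>x\<in>K. dist (\<phi> x) 1 < e" "x \<in> X"
    then show "dist (\<phi> x) 1 < d" using near[of \<phi> x] XH by auto
  qed
qed

end

theorem theorem1p2:
  fixes G :: "('a, 'b) monoid_scheme" and T :: "'a topology" and X :: "'a set"
  assumes "locally_compact_group G T" and "X \<subseteq> carrier G"
  shows "relative_property_T G T X \<longleftrightarrow>
    (\<exists>H. subgroup H G \<and> openin T H \<and>
         compactly_generated (G\<lparr>carrier := H\<rparr>) (subtopology T H) \<and> X \<subseteq> H \<and>
         relative_property_T (G\<lparr>carrier := H\<rparr>) (subtopology T H) X)"
proof
  interpret locally_compact_group G T by fact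
  assume "relative_property_T G T X"
  \<comment> \<open>The tolerance \<open>1/2\<close> is at most \<open>1\<close>, as the inclusion
    \<open>X \<subseteq> H\<close> requires, and is small enough for the self-improvement on
    \<open>H\<close>.\<close>
  then obtain K e where K: "compactin T K" "e > 0" "controls G T X K e (1/2)"
    unfolding relative_property_T_iff_controls by (meson half_gt_zero zero_less_one)
  obtain H where H: "subgroup H G" "openin T H" "K \<subseteq> H"
      "compactly_generated (G\<lparr>carrier := H\<rparr>) (subtopology T H)"
    using compact_in_open_compactly_generated_subgroup[OF K(1)] .
  have *: "X \<subseteq> H" "controls (G\<lparr>carrier := H\<rparr>) (subtopology T H) X K e (1/2)"
    using controls_open_subgroup[OF H(1-3) K(3,2)] by simp_all
  moreover have "compactin (subtopology T H) K"
    using K(1) H(3) by (simp add: compactin_subtopology)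
  ultimately have "relative_property_T (G\<lparr>carrier := H\<rparr>) (subtopology T H) X"
    using relative_property_T_if_controls_half K(2) by blast
  then show "\<exists>H. subgroup H G \<and> openin T H \<and>
      compactly_generated (G\<lparr>carrier := H\<rparr>) (subtopology T H) \<and> X \<subseteq> H \<and>
      relative_property_T (G\<lparr>carrier := H\<rparr>) (subtopology T H) X"
    using H *(1) by blast
next
  interpret locally_compact_group G T by fact
  show "relative_property_T G T X" if "\<exists>H. subgroup H G \<and> openin T H \<and>
      compactly_generated (G\<lparr>carrier := H\<rparr>) (subtopology T H) \<and> X \<subseteq> H \<and>
      relative_property_T (G\<lparr>carrier := H\<rparr>) (subtopology T H) X"
    using that relative_property_T_if_subgroup by blast
qed

end
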